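(* For any consistent normal modal logic $L$, the following are equivalent: (1) for any formula $\varphi$ and any finite sets $P,Q$ of propositional variables there exists a uniform Lyndon interpolant $\theta$ of $(\varphi,P,Q)$ in $L$ with $d(\theta)\le d(\varphi)$; (2) $L$ is sound and complete with respect to some class $\mathcal{C}$ of Kripke models having ULIP.
   Context: Formulas are built from propositional variables, $\bot$, $\to$, $\Box$. Modal depth: $d(p)=d(\bot)=0$, $d(\varphi\to\psi)=\max\{d(\varphi),d(\psi)\}$, $d(\Box\varphi)=d(\varphi)+1$. Positive/negative variable sets: $v^+(p)=\{p\}$, $v^-(p)=\emptyset$; $v^\pm(\bot)=\emptyset$; $v^+(\psi\to\theta)=v^-(\psi)\cup v^+(\theta)$, $v^-(\psi\to\theta)=v^+(\psi)\cup v^-(\theta)$; $v^\pm(\Box\psi)=v^\pm(\psi)$. A normal logic contains all tautologies and $\Box(p\to q)\to(\Box p\to\Box q)$ and is closed under modus ponens, necessitation, uniform substitution; $L\vdash\varphi$ means $\varphi\in L$. A uniform Lyndon interpolant of $(\varphi,P,Q)$ in $L$ is a $\theta$ with $v^+(\theta)\subseteq v^+(\varphi)\setminus P$, $v^-(\theta)\subseteq v^-(\varphi)\setminus Q$, $L\vdash\varphi\to\theta$, and $L\vdash\theta\to\psi$ for all $\psi$ with $v^+(\psi)\cap P=v^-(\psi)\cap Q=\emptyset$ and $L\vdash\varphi\to\psi$. A Kripke model $(W,\prec,\Vdash)$: $W$ nonempty, $\prec$ binary relation, $\Vdash$ satisfaction with $x\Vdash\Box\varphi$ iff $y\Vdash\varphi$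 for all $y\succ x$. $L$ is sound and complete w.r.t. a class $\mathcal{C}$ if $L\vdash\varphi$ iff $\varphi$ is true at every world of every model in $\mathcal{C}$. A $(P,Q)$-formula is one with $v^+\subseteq P$, $v^-\subseteq Q$; $F_n^{(P,Q)}$ is a fixed finite set of $(P,Q)$-formulas of depth $\le n$ representing every such formula up to $\mathbf{K}$-equivalence, and $\mathrm{Th}_n^{(P,Q)}(w)=\{\varphi\in F_n^{(P,Q)}:w\Vdash\varphi\}$. A class $\mathcal{C}$ of Kripke models has ULIP if for all finite sets $P_1,P_2,P_3$ (pairwise disjoint) and $Q_1,Q_2,Q_3$ (pairwise disjoint) of variables, all $M=(W,\prec,\Vdash)$, $M'=(W',\prec',\Vdash')$ in $\mathcal{C}$, $w\in W$, $w'\in W'$ and $m,n\in\omega$: if $\mathrm{Th}_n^{(P_2,Q_2)}(w)\subseteq\mathrm{Th}_n^{(P_2,Q_2)}(w')$, then there are $M^*=(W^*,\prec^*,\Vdash^* )$ in $\mathcal{C}$ and $w^*\in W^*$ with $\mathrm{Th}_n^{(P_1\cup P_2,Q_1\cup Q_2)}(w)\subseteq\mathrm{Th}_n^{(P_1\cup P_2,Q_1\cup Q_2)}(w^* )$ and $\mathrm{Th}_m^{(P_2\cup P_3,Q_2\cup Q_3)}(w^* )\subseteq\mathrm{Th}_m^{(P_2\cup P_3,Q_2\cup Q_3)}(w')$. *)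

theory Defs
  imports Main
begin

datatype fm =
    Var nat
  | Bot (\<open>\<^bold>\<bottom>\<close>)
  | Imp fm fm (infixr \<open>\<^bold>\<rightarrow>\<close> 55)
  | Box fm (\<open>\<^bold>\<box>_\<close> [70] 70)

primrec depth :: "fm \<Rightarrow> nat" where
  "depth (Var p) = 0"
| "depth \<^bold>\<bottom> = 0"
| "depth (\<phi> \<^bold>\<rightarrow> \<psi>) = max (depth \<phi>) (depth \<psi>)"
| "depth (\<^bold>\<box>\<phi>) = depth \<phi> + 1"

fun vpos :: "fm \<Rightarrow> nat set" and vneg :: "fm \<Rightarrow> nat set" where
  "vpos (Var p) = {p}"
| "vpos \<^bold>\<bottom> = {}"
| "vpos (\<psi> \<^bold>\<rightarrow> \<theta>) = vneg \<psi> \<union> vpos \<theta>"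
| "vpos (\<^bold>\<box>\<psi>) = vpos \<psi>"
| "vneg (Var p) = {}"
| "vneg \<^bold>\<bottom> = {}"
| "vneg (\<psi> \<^bold>\<rightarrow> \<theta>) = vpos \<psi> \<union> vneg \<theta>"
| "vneg (\<^bold>\<box>\<psi>) = vneg \<psi>"

primrec subst :: "(nat \<Rightarrow> fm) \<Rightarrow> fm \<Rightarrow> fm" where
  "subst s (Var p) = s p"
| "subst s \<^bold>\<bottom> = \<^bold>\<bottom>"
| "subst s (\<phi> \<^bold>\<rightarrow> \<psi>) = (subst s \<phi> \<^bold>\<rightarrow> subst s \<psi>)"
| "subst s (\<^bold>\<box>\<phi>) = \<^bold>\<box>(subst s \<phi>)"

text \<open>Propositional evaluation: variables and boxed formulas are both treated as atoms.\<close>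

primrec peval :: "(fm \<Rightarrow> bool) \<Rightarrow> fm \<Rightarrow> bool" where
  "peval v (Var p) = v (Var p)"
| "peval v \<^bold>\<bottom> = False"
| "peval v (\<phi> \<^bold>\<rightarrow> \<psi>) = (peval v \<phi> \<longrightarrow> peval v \<psi>)"
| "peval v (\<^bold>\<box>\<phi>) = v (\<^bold>\<box>\<phi>)"

definition tautology :: "fm \<Rightarrow> bool" where
  "tautology \<phi> \<longleftrightarrow> (\<forall>v. peval v \<phi>)"

definition normal_logic :: "fm set \<Rightarrow> bool" where
  "normal_logic L \<longleftrightarrow>
     (\<forall>\<phi>. tautology \<phi> \<longrightarrow> \<phi> \<in> L) \<and>
     (\<forall>p q. (\<^bold>\<box>(Var p \<^bold>\<rightarrow> Var q) \<^bold>\<rightarrow> (\<^bold>\<box>(Var p) \<^bold>\<rightarrow> \<^bold>\<box>(Var q))) \<in> L) \<and>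
     (\<forall>\<phi> \<psi>. (\<phi> \<^bold>\<rightarrow> \<psi>) \<in> L \<longrightarrow> \<phi> \<in> L \<longrightarrow> \<psi> \<in> L) \<and>
     (\<forall>\<phi>. \<phi> \<in> L \<longrightarrow> \<^bold>\<box>\<phi> \<in> L) \<and>
     (\<forall>\<phi> s. \<phi> \<in> L \<longrightarrow> subst s \<phi> \<in> L)"

definition consistent :: "fm set \<Rightarrow> bool" where
  "consistent L \<longleftrightarrow> \<^bold>\<bottom> \<notin> L"

definition K :: "fm set" where
  "K = \<Inter> {L. normal_logic L}"

definition K_equiv :: "fm \<Rightarrow> fm \<Rightarrow> bool" where
  "K_equiv \<phi> \<psi> \<longleftrightarrow> (\<phi> \<^bold>\<rightarrow> \<psi>) \<in> K \<and> (\<psi> \<^bold>\<rightarrow> \<phi>) \<in> K"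

definition uniform_lyndon_interpolant ::
    "fm set \<Rightarrow> fm \<Rightarrow> nat set \<Rightarrow> nat set \<Rightarrow> fm \<Rightarrow> bool" where
  "uniform_lyndon_interpolant L \<phi> P Q \<theta> \<longleftrightarrow>
     vpos \<theta> \<subseteq> vpos \<phi> - P \<and> vneg \<theta> \<subseteq> vneg \<phi> - Q \<and>
     (\<phi> \<^bold>\<rightarrow> \<theta>) \<in> L \<and>
     (\<forall>\<psi>. vpos \<psi> \<inter> P = {} \<longrightarrow> vneg \<psi> \<inter> Q = {} \<longrightarrow> (\<phi> \<^bold>\<rightarrow> \<psi>) \<in> L \<longrightarrow> (\<theta> \<^bold>\<rightarrow> \<psi>) \<in> L)"

definition bounded_uniform_lyndon :: "fm set \<Rightarrow> bool" where
  "bounded_uniform_lyndon L \<longleftrightarrow>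
     (\<forall>\<phi> P Q. finite P \<longrightarrow> finite Q \<longrightarrow>
        (\<exists>\<theta>. uniform_lyndon_interpolant L \<phi> P Q \<theta> \<and> depth \<theta> \<le> depth \<phi>))"

text \<open>The satisfaction relation of a Kripke model is determined by its restriction to
  variables, so a model carries only the latter (\<open>val\<close>).\<close>

record 'w kripke =
  worlds :: "'w set"
  rel :: "('w \<times> 'w) set"
  val :: "'w \<Rightarrow> nat \<Rightarrow> bool"

definition kripke_model :: "'w kripke \<Rightarrow> bool" where
  "kripke_model M \<longleftrightarrow> worlds M \<noteq> {} \<and> rel M \<subseteq> worlds M \<times> worlds M"

primrec sat :: "'w kripke \<Rightarrow> 'w \<Rightarrow> fm \<Rightarrow> bool" where
  "sat M x (Var p) = val M x p"
| "sat M x \<^bold>\<bottom> = False"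
| "sat M x (\<phi> \<^bold>\<rightarrow> \<psi>) = (sat M x \<phi> \<longrightarrow> sat M x \<psi>)"
| "sat M x (\<^bold>\<box>\<phi>) = (\<forall>y. (x, y) \<in> rel M \<longrightarrow> sat M y \<phi>)"

definition sound_complete :: "fm set \<Rightarrow> 'w kripke set \<Rightarrow> bool" where
  "sound_complete L C \<longleftrightarrow> (\<forall>\<phi>. \<phi> \<in> L \<longleftrightarrow> (\<forall>M \<in> C. \<forall>w \<in> worlds M. sat M w \<phi>))"

definition PQ_formulas :: "nat \<Rightarrow> nat set \<Rightarrow> nat set \<Rightarrow> fm set" where
  "PQ_formulas n P Q = {\<phi>. vpos \<phi> \<subseteq> P \<and> vneg \<phi> \<subseteq> Q \<and> depth \<phi> \<le> n}"

definition representatives :: "nat \<Rightarrow> nat set \<Rightarrow> nat set \<Rightarrow> fm set \<Rightarrow> bool" where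
  "representatives n P Q F \<longleftrightarrow>
     finite F \<and> F \<subseteq> PQ_formulas n P Q \<and>
     (\<forall>\<phi> \<in> PQ_formulas n P Q. \<exists>\<psi> \<in> F. K_equiv \<phi> \<psi>)"

text \<open>A fixed choice of representatives; it is meaningful only for finite \<open>P\<close> and \<open>Q\<close>,
  see \<open>representatives_F\<close> below.\<close>

definition F :: "nat \<Rightarrow> nat set \<Rightarrow> nat set \<Rightarrow> fm set" where
  "F n P Q = (SOME F. representatives n P Q F)"

definition Th :: "nat \<Rightarrow> nat set \<Rightarrow> nat set \<Rightarrow> 'w kripke \<Rightarrow> 'w \<Rightarrow> fm set" where
  "Th n P Q M w = {\<phi> \<in> F n P Q. sat M w \<phi>}"

definition ULIP :: "'w kripke set \<Rightarrow> bool" where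
  "ULIP C \<longleftrightarrow>
     (\<forall>P1 P2 P3 Q1 Q2 Q3.
        finite P1 \<and> finite P2 \<and> finite P3 \<and> finite Q1 \<and> finite Q2 \<and> finite Q3 \<and>
        P1 \<inter> P2 = {} \<and> P1 \<inter> P3 = {} \<and> P2 \<inter> P3 = {} \<and>
        Q1 \<inter> Q2 = {} \<and> Q1 \<inter> Q3 = {} \<and> Q2 \<inter> Q3 = {} \<longrightarrow>
        (\<forall>M \<in> C. \<forall>M' \<in> C. \<forall>w \<in> worlds M. \<forall>w' \<in> worlds M'. \<forall>m n.
           Th n P2 Q2 M w \<subseteq> Th n P2 Q2 M' w' \<longrightarrow>
           (\<exists>M'' \<in> C. \<exists>w'' \<in> worlds M''.
              Th n (P1 \<union> P2) (Q1 \<union> Q2) M w \<subseteq> Th n (P1 \<union> P2) (Q1 \<union> Q2) M'' w'' \<and>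
              Th m (P2 \<union> P3) (Q2 \<union> Q3) M'' w'' \<subseteq> Th m (P2 \<union> P3) (Q2 \<union> Q3) M' w')))"

subsection \<open>Existence of finite sets of representatives\<close>

lemma normal_logic_K: "normal_logic K"
  unfolding K_def normal_logic_def by blast

lemma K_taut: "tautology \<phi> \<Longrightarrow> \<phi> \<in> K"
  and K_mp: "(\<phi> \<^bold>\<rightarrow> \<psi>) \<in> K \<Longrightarrow> \<phi> \<in> K \<Longrightarrow> \<psi> \<in> K"
  and K_nec: "\<phi> \<in> K \<Longrightarrow> \<^bold>\<box>\<phi> \<in> K"
  and K_subst: "\<phi> \<in> K \<Longrightarrow> subst s \<phi> \<in> K"
  using normal_logic_K unfolding normal_logic_def by blast+

lemma K_dist: "(\<^bold>\<box>(\<phi> \<^bold>\<rightarrow> \<psi>) \<^bold>\<rightarrow> (\<^bold>\<box>\<phi> \<^bold>\<rightarrow> \<^bold>\<box>\<psi>)) \<in> K"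
proof -
  have "(\<^bold>\<box>(Var 0 \<^bold>\<rightarrow> Var 1) \<^bold>\<rightarrow> (\<^bold>\<box>(Var 0) \<^bold>\<rightarrow> \<^bold>\<box>(Var 1))) \<in> K"
    using normal_logic_K unfolding normal_logic_def by blast
  from K_subst[OF this, of "\<lambda>i. if i = 0 then \<phi> else \<psi>"] show ?thesis by simp
qed

lemma K_mp2: "tautology (\<alpha> \<^bold>\<rightarrow> \<beta> \<^bold>\<rightarrow> \<gamma>) \<Longrightarrow> \<alpha> \<in> K \<Longrightarrow> \<beta> \<in> K \<Longrightarrow> \<gamma> \<in> K"
  by (meson K_mp K_taut)

lemma K_equiv_sym: "K_equiv \<phi> \<psi> \<Longrightarrow> K_equiv \<psi> \<phi>"
  by (simp add: K_equiv_def)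

lemma K_equiv_trans: "K_equiv \<phi> \<psi> \<Longrightarrow> K_equiv \<psi> \<chi> \<Longrightarrow> K_equiv \<phi> \<chi>"
  unfolding K_equiv_def
  by (auto intro: K_mp2[of "\<phi> \<^bold>\<rightarrow> \<psi>" "\<psi> \<^bold>\<rightarrow> \<chi>"] K_mp2[of "\<chi> \<^bold>\<rightarrow> \<psi>" "\<psi> \<^bold>\<rightarrow> \<phi>"] simp: tautology_def)

lemma K_equiv_taut: "(\<And>v. peval v \<phi> = peval v \<psi>) \<Longrightarrow> K_equiv \<phi> \<psi>"
  by (simp add: K_equiv_def K_taut tautology_def)

lemma K_equiv_Imp: "K_equiv \<phi> \<phi>' \<Longrightarrow> K_equiv \<psi> \<psi>' \<Longrightarrow> K_equiv (\<phi> \<^bold>\<rightarrow> \<psi>) (\<phi>' \<^bold>\<rightarrow> \<psi>')"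
  unfolding K_equiv_def
  by (auto intro: K_mp2[of "\<phi>' \<^bold>\<rightarrow> \<phi>" "\<psi> \<^bold>\<rightarrow> \<psi>'"] K_mp2[of "\<phi> \<^bold>\<rightarrow> \<phi>'" "\<psi>' \<^bold>\<rightarrow> \<psi>"]
      simp: tautology_def)

lemma K_equiv_Box: "K_equiv \<phi> \<psi> \<Longrightarrow> K_equiv (\<^bold>\<box>\<phi>) (\<^bold>\<box>\<psi>)"
  unfolding K_equiv_def by (meson K_dist K_mp K_nec)

lemma finite_representatives:
  assumes "finite (f ` S)" and "\<And>\<phi> \<psi>. \<phi> \<in> S \<Longrightarrow> \<psi> \<in> S \<Longrightarrow> f \<phi> = f \<psi> \<Longrightarrow> K_equiv \<phi> \<psi>"
  shows "\<exists>G. finite G \<and> G \<subseteq> S \<and> (\<forall>\<phi> \<in> S. \<exists>\<psi> \<in> G. K_equiv \<phi> \<psi>)"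
proof (intro exI conjI ballI)
  let ?G = "inv_into S f ` f ` S"
  show "finite ?G" using assms(1) by simp
  show "?G \<subseteq> S" by (auto intro: inv_into_into)
  fix \<phi> assume "\<phi> \<in> S"
  then show "\<exists>\<psi> \<in> ?G. K_equiv \<phi> \<psi>"
    by (intro bexI[of _ "inv_into S f (f \<phi>)"] assms(2)) (auto intro: inv_into_into simp: f_inv_into_f)
qed

primrec replace_boxes :: "(fm \<Rightarrow> fm) \<Rightarrow> fm \<Rightarrow> fm" where
  "replace_boxes r (Var p) = Var p"
| "replace_boxes r \<^bold>\<bottom> = \<^bold>\<bottom>"
| "replace_boxes r (\<phi> \<^bold>\<rightarrow> \<psi>) = (replace_boxes r \<phi> \<^bold>\<rightarrow> replace_boxes r \<psi>)"
| "replace_boxes r (\<^bold>\<box>\<phi>) = \<^bold>\<box>(r \<phi>)"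

lemma finite_representatives_step:
  assumes V: "finite V" and G: "finite G"
    and r: "\<And>\<phi>. \<^bold>\<box>\<phi> \<in> PQ_formulas n V V \<Longrightarrow> r \<phi> \<in> G \<and> K_equiv \<phi> (r \<phi>)"
  shows "\<exists>H. representatives n V V H"
proof -
  let ?D = "PQ_formulas n V V"
  define A where "A = Var ` V \<union> Box ` G"
  define sig where "sig \<phi> = {X \<in> Pow A. peval (\<lambda>a. a \<in> X) (replace_boxes r \<phi>)}" for \<phi>
  have D_Imp: "\<phi> \<in> ?D \<and> \<psi> \<in> ?D" if "(\<phi> \<^bold>\<rightarrow> \<psi>) \<in> ?D" for \<phi> \<psi>
    using that by (simp add: PQ_formulas_def)
  have D_Var: "p \<in> V" if "Var p \<in> ?D" for p
    using that by (simp add: PQ_formulas_def)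
  have rb: "K_equiv \<phi> (replace_boxes r \<phi>)" if "\<phi> \<in> ?D" for \<phi>
    using that
    by (induction \<phi>) (auto intro: K_equiv_taut K_equiv_Imp K_equiv_Box dest: r D_Imp)
  have restrict: "peval v (replace_boxes r \<phi>) = peval (\<lambda>a. a \<in> {a \<in> A. v a}) (replace_boxes r \<phi>)"
    if "\<phi> \<in> ?D" for \<phi> v
    using that
    by (induction \<phi>) (auto simp: A_def dest: r D_Imp D_Var)
  have "K_equiv \<phi> \<psi>" if "\<phi> \<in> ?D" "\<psi> \<in> ?D" "sig \<phi> = sig \<psi>" for \<phi> \<psi>
  proof -
    have "peval v (replace_boxes r \<phi>) = peval v (replace_boxes r \<psi>)" for v
    proof -
      have "{a \<in> A. v a} \<in> sig \<phi> \<longleftrightarrow> {a \<in> A. v a} \<in> sig \<psi>"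
        using that(3) by simp
      then show ?thesis
        unfolding restrict[OF that(1), of v] restrict[OF that(2), of v] sig_def by blast
    qed
    then show ?thesis
      by (meson K_equiv_sym K_equiv_taut K_equiv_trans rb that)
  qed
  moreover have "finite (sig ` ?D)"
    by (rule finite_subset[of _ "Pow (Pow A)"]) (auto simp: sig_def A_def V G)
  ultimately show ?thesis
    using finite_representatives[of sig ?D] by (simp add: representatives_def)
qed

lemma representatives_ex_same:
  assumes "finite V"
  shows "\<exists>H. representatives n V V H"
proof (induction n)
  case 0
  show ?case
    by (rule finite_representatives_step[of V "{}"]) (auto simp: assms PQ_formulas_def)
next
  case (Suc n)
  then obtain G where G: "representatives n V V G" by blast
  then have "\<exists>r. \<forall>\<phi> \<in> PQ_formulas n V V. r \<phi> \<in> G \<and> K_equiv \<phi> (r \<phi>)"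
    unfolding representatives_def by metis
  then obtain r where "\<forall>\<phi> \<in> PQ_formulas n V V. r \<phi> \<in> G \<and> K_equiv \<phi> (r \<phi>)" by blast
  then show ?case
    using G by (intro finite_representatives_step[of V G _ r])
      (auto simp: assms PQ_formulas_def representatives_def)
qed

lemma representatives_F:
  assumes "finite P" "finite Q"
  shows "representatives n P Q (F n P Q)"
proof -
  let ?V = "P \<union> Q"
  obtain G where G: "representatives n ?V ?V G"
    using representatives_ex_same assms by blast
  have sub: "PQ_formulas n P Q \<subseteq> PQ_formulas n ?V ?V"
    by (auto simp: PQ_formulas_def)
  then have "\<exists>r. \<forall>\<phi> \<in> PQ_formulas n P Q. r \<phi> \<in> G \<and> K_equiv \<phi> (r \<phi>)"
    using G unfolding representatives_def by (metis subsetD)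
  then obtain r where r: "\<And>\<phi>. \<phi> \<in> PQ_formulas n P Q \<Longrightarrow> r \<phi> \<in> G \<and> K_equiv \<phi> (r \<phi>)" by blast
  have "finite (r ` PQ_formulas n P Q)"
    using G r by (meson finite_subset image_subsetI representatives_def)
  moreover have "K_equiv \<phi> \<psi>"
    if "\<phi> \<in> PQ_formulas n P Q" "\<psi> \<in> PQ_formulas n P Q" "r \<phi> = r \<psi>" for \<phi> \<psi>
    using r that by (metis K_equiv_sym K_equiv_trans)
  ultimately have "\<exists>H. representatives n P Q H"
    using finite_representatives[of r "PQ_formulas n P Q"] by (simp add: representatives_def)
  then show ?thesis
    unfolding F_def by (rule someI_ex)
qed

end

theory Submission
  imports Defs
begin

text \<open>
  If \<open>L\<close> is sound and complete for a class \<open>C\<close> of models, then \<open>C\<close> has ULIP iff \<open>L\<close> has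
  depth-bounded uniform Lyndon interpolation; since every consistent normal logic is complete for
  its canonical model, this suffices.
  A failure of ULIP at \<open>w\<close>, \<open>w'\<close> means that the conjunction of the \<open>n\<close>-theory of \<open>w\<close> implies
  in \<open>L\<close> the disjunction of the depth \<open>m\<close> formulas refuted at \<open>w'\<close>; a depth-bounded interpolant
  would be true at \<open>w\<close>, hence at \<open>w'\<close>. Conversely, the conjunction \<open>\<theta>\<close> of all
  consequences of \<open>\<phi>\<close> of depth at most \<open>d(\<phi>)\<close> in the admissible signature is an interpolant:
  if \<open>\<theta>\<close> holds at \<open>w'\<close>, then the theory of \<open>w'\<close> includes that of some world satisfying \<open>\<phi>\<close>,
  and ULIP transfers any consequence \<open>\<psi>\<close> of \<open>\<phi>\<close> to \<open>w'\<close>.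
\<close>

section \<open>The canonical model\<close>

text \<open>This is local consequence: assumptions are never necessitated, which is what makes
  \<open>deduction\<close> hold. Boxes enter only through \<open>L\<close>, itself closed under
  necessitation.\<close>

inductive derivable :: "fm set \<Rightarrow> fm set \<Rightarrow> fm \<Rightarrow> bool" for L S where
  logic: "\<phi> \<in> L \<Longrightarrow> derivable L S \<phi>"
| assm: "\<phi> \<in> S \<Longrightarrow> derivable L S \<phi>"
| mp: "derivable L S (\<phi> \<^bold>\<rightarrow> \<psi>) \<Longrightarrow> derivable L S \<phi> \<Longrightarrow> derivable L S \<psi>"

definition maximal_consistent :: "fm set \<Rightarrow> fm set \<Rightarrow> bool" where
  "maximal_consistent L w \<longleftrightarrow>
     \<not> derivable L w \<^bold>\<bottom> \<and> (\<forall>S. w \<subseteq> S \<longrightarrow> \<not> derivable L S \<^bold>\<bottom> \<longrightarrow> S = w)"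

text \<open>Both ends of \<open>rel\<close> are required to be maximal consistent so that the
  relation stays within \<open>worlds\<close>, as \<open>kripke_model\<close> demands.\<close>

definition canonical_model :: "fm set \<Rightarrow> fm set kripke" where
  "canonical_model L =
     \<lparr>worlds = {w. maximal_consistent L w},
      rel = {(w, v). maximal_consistent L w \<and> maximal_consistent L v \<and>
                     (\<forall>\<phi>. \<^bold>\<box>\<phi> \<in> w \<longrightarrow> \<phi> \<in> v)},
      val = (\<lambda>w p. Var p \<in> w)\<rparr>"

lemma derivable_mono: "derivable L S \<phi> \<Longrightarrow> S \<subseteq> T \<Longrightarrow> derivable L T \<phi>"
  by (induction rule: derivable.induct) (auto intro: derivable.intros)

text \<open>Compactness, which lets Zorn's lemma be applied: a derivation of \<open>Bot\<close> from
  the union of a chain already lives in one member of the chain.\<close>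

lemma derivable_finite: "derivable L S \<phi> \<Longrightarrow> \<exists>T. finite T \<and> T \<subseteq> S \<and> derivable L T \<phi>"
proof (induction rule: derivable.induct)
  case (logic \<phi>)
  then show ?case by (auto intro!: exI[of _ "{}"] derivable.logic)
next
  case (assm \<phi>)
  then show ?case by (intro exI[of _ "{\<phi>}"]) (auto intro: derivable.assm)
next
  case (mp \<phi> \<psi>)
  then obtain T U where "finite T" "T \<subseteq> S" "derivable L T (\<phi> \<^bold>\<rightarrow> \<psi>)"
    "finite U" "U \<subseteq> S" "derivable L U \<phi>" by blast
  then show ?case
    by (intro exI[of _ "T \<union> U"]) (auto intro: derivable.mp derivable_mono)
qed

lemma Lindenbaum:
  assumes "\<not> derivable L S \<^bold>\<bottom>"
  obtains w where "maximal_consistent L w" "S \<subseteq> w"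
proof -
  let ?A = "{T. S \<subseteq> T \<and> \<not> derivable L T \<^bold>\<bottom>}"
  have "\<exists>w \<in> ?A. \<forall>T \<in> ?A. w \<subseteq> T \<longrightarrow> T = w"
  proof (rule subset_Zorn_nonempty)
    show "?A \<noteq> {}" using assms by blast
    fix \<C> assume "\<C> \<noteq> {}" and chain: "subset.chain ?A \<C>"
    then have ne: "\<C> \<noteq> {}" and sub: "\<C> \<subseteq> ?A" by (auto simp: subset.chain_def)
    have "\<not> derivable L (\<Union>\<C>) \<^bold>\<bottom>"
    proof
      assume "derivable L (\<Union>\<C>) \<^bold>\<bottom>"
      then obtain T where T: "finite T" "T \<subseteq> \<Union>\<C>" "derivable L T \<^bold>\<bottom>"
        by (auto dest: derivable_finite)
      obtain U where "U \<in> \<C>" "T \<subseteq> U"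
        by (rule finite_subset_Union_chain[OF T(1,2) ne chain])
      then show False using derivable_mono[OF T(3)] sub by blast
    qed
    then show "\<Union>\<C> \<in> ?A" using ne sub by blast
  qed
  then obtain w where w: "w \<in> ?A" "\<forall>T \<in> ?A. w \<subseteq> T \<longrightarrow> T = w" by blast
  then have "maximal_consistent L w"
    unfolding maximal_consistent_def by blast
  then show ?thesis using w(1) that by blast
qed

section \<open>Maximal consistent sets and canonical completeness\<close>

locale normal =
  fixes L :: "fm set"
  assumes normal_logic: "normal_logic L"
begin

lemma taut: "tautology \<phi> \<Longrightarrow> \<phi> \<in> L"
  and modus_ponens: "(\<phi> \<^bold>\<rightarrow> \<psi>) \<in> L \<Longrightarrow> \<phi> \<in> L \<Longrightarrow> \<psi> \<in> L"
  and necessitation: "\<phi> \<in> L \<Longrightarrow> \<^bold>\<box>\<phi> \<in> L"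
  using normal_logic unfolding normal_logic_def by blast+

lemma K_subset: "K \<subseteq> L"
  using normal_logic unfolding K_def by blast

lemma derivable_taut: "tautology \<phi> \<Longrightarrow> derivable L S \<phi>"
  by (intro derivable.logic taut)

lemma deduction: "derivable L (insert \<alpha> S) \<phi> \<Longrightarrow> derivable L S (\<alpha> \<^bold>\<rightarrow> \<phi>)"
proof (induction rule: derivable.induct)
  case (logic \<phi>)
  have "derivable L S (\<phi> \<^bold>\<rightarrow> \<alpha> \<^bold>\<rightarrow> \<phi>)"
    by (rule derivable_taut) (simp add: tautology_def)
  then show ?case using logic by (blast intro: derivable.intros)
next
  case (assm \<phi>)
  have "derivable L S (\<phi> \<^bold>\<rightarrow> \<alpha> \<^bold>\<rightarrow> \<phi>)" "derivable L S (\<alpha> \<^bold>\<rightarrow> \<alpha>)"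
    by (rule derivable_taut, simp add: tautology_def)+
  then show ?case using assm by (blast intro: derivable.intros)
next
  case (mp \<phi> \<psi>)
  have "derivable L S ((\<alpha> \<^bold>\<rightarrow> \<phi> \<^bold>\<rightarrow> \<psi>) \<^bold>\<rightarrow> (\<alpha> \<^bold>\<rightarrow> \<phi>) \<^bold>\<rightarrow> (\<alpha> \<^bold>\<rightarrow> \<psi>))"
    by (rule derivable_taut) (simp add: tautology_def)
  then show ?case using mp.IH by (blast intro: derivable.mp)
qed

lemma derivable_by_contradiction:
  assumes "derivable L (insert (\<phi> \<^bold>\<rightarrow> \<^bold>\<bottom>) S) \<^bold>\<bottom>"
  shows "derivable L S \<phi>"
proof -
  have "derivable L S (((\<phi> \<^bold>\<rightarrow> \<^bold>\<bottom>) \<^bold>\<rightarrow> \<^bold>\<bottom>) \<^bold>\<rightarrow> \<phi>)"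
    by (rule derivable_taut) (simp add: tautology_def)
  then show ?thesis using deduction[OF assms] by (rule derivable.mp)
qed

lemma derivable_empty: "derivable L {} \<phi> \<Longrightarrow> \<phi> \<in> L"
  by (induction rule: derivable.induct) (auto intro: modus_ponens)

context
  fixes w
  assumes w: "maximal_consistent L w"
begin

lemma mcs_insert: "\<phi> \<notin> w \<Longrightarrow> derivable L (insert \<phi> w) \<^bold>\<bottom>"
  using w unfolding maximal_consistent_def by blast

lemma mcs_derivable: "derivable L w \<phi> \<longleftrightarrow> \<phi> \<in> w"
proof
  assume *: "derivable L w \<phi>"
  show "\<phi> \<in> w"
  proof (rule ccontr)
    assume "\<phi> \<notin> w"
    then have "derivable L w (\<phi> \<^bold>\<rightarrow> \<^bold>\<bottom>)" by (intro deduction mcs_insert)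
    then show False using * w derivable.mp unfolding maximal_consistent_def by blast
  qed
qed (rule derivable.assm)

lemma mcs_Bot: "\<^bold>\<bottom> \<notin> w"
  using w mcs_derivable unfolding maximal_consistent_def by blast

lemma mcs_Imp: "(\<phi> \<^bold>\<rightarrow> \<psi>) \<in> w \<longleftrightarrow> (\<phi> \<in> w \<longrightarrow> \<psi> \<in> w)"
proof
  assume "(\<phi> \<^bold>\<rightarrow> \<psi>) \<in> w"
  then show "\<phi> \<in> w \<longrightarrow> \<psi> \<in> w" by (metis mcs_derivable derivable.mp)
next
  assume *: "\<phi> \<in> w \<longrightarrow> \<psi> \<in> w"
  have "derivable L w (\<psi> \<^bold>\<rightarrow> \<phi> \<^bold>\<rightarrow> \<psi>)" "derivable L w ((\<phi> \<^bold>\<rightarrow> \<^bold>\<bottom>) \<^bold>\<rightarrow> \<phi> \<^bold>\<rightarrow> \<psi>)"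
    by (rule derivable_taut, simp add: tautology_def)+
  moreover have "derivable L w \<psi> \<or> derivable L w (\<phi> \<^bold>\<rightarrow> \<^bold>\<bottom>)"
    using * deduction mcs_insert mcs_derivable by blast
  ultimately show "(\<phi> \<^bold>\<rightarrow> \<psi>) \<in> w" by (metis mcs_derivable derivable.mp)
qed

text \<open>The set of formulas whose box is in \<open>w\<close> contains \<open>L\<close> by
  necessitation and is closed under modus ponens by distribution of the box, hence closed under
  derivability.\<close>

lemma mcs_unbox: "derivable L {\<psi>. \<^bold>\<box>\<psi> \<in> w} \<phi> \<Longrightarrow> \<^bold>\<box>\<phi> \<in> w"
proof (induction rule: derivable.induct)
  case (logic \<phi>)
  then show ?case using mcs_derivable necessitation derivable.logic by blast
next
  case (mp \<phi> \<psi>)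
  have "derivable L w (\<^bold>\<box>(\<phi> \<^bold>\<rightarrow> \<psi>) \<^bold>\<rightarrow> (\<^bold>\<box>\<phi> \<^bold>\<rightarrow> \<^bold>\<box>\<psi>))"
    using K_dist K_subset by (blast intro: derivable.logic)
  then show ?case using mp.IH by (metis mcs_derivable derivable.mp)
qed simp

end

lemma truth_lemma: "maximal_consistent L w \<Longrightarrow> sat (canonical_model L) w \<phi> \<longleftrightarrow> \<phi> \<in> w"
proof (induction \<phi> arbitrary: w)
  case (Box \<phi>)
  have "\<exists>v. (w, v) \<in> rel (canonical_model L) \<and> \<phi> \<notin> v" if "\<^bold>\<box>\<phi> \<notin> w"
  proof -
    \<comment> \<open>Otherwise the unboxed formulas of \<open>w\<close> would derive \<phi>, and
      \<open>mcs_unbox\<close> would put its box into \<open>w\<close>. A maximal consistent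
      extension of this set is the successor refuting \<phi>.\<close>
    have "\<not> derivable L (insert (\<phi> \<^bold>\<rightarrow> \<^bold>\<bottom>) {\<psi>. \<^bold>\<box>\<psi> \<in> w}) \<^bold>\<bottom>"
      using that derivable_by_contradiction mcs_unbox[OF Box.prems] by blast
    then obtain v where v: "maximal_consistent L v" "insert (\<phi> \<^bold>\<rightarrow> \<^bold>\<bottom>) {\<psi>. \<^bold>\<box>\<psi> \<in> w} \<subseteq> v"
      by (rule Lindenbaum)
    then have "\<phi> \<notin> v" using mcs_Imp[OF v(1), of \<phi> "\<^bold>\<bottom>"] mcs_Bot[OF v(1)] by blast
    then show ?thesis using v Box.prems by (auto simp: canonical_model_def)
  qed
  moreover have "maximal_consistent L v \<and> (\<^bold>\<box>\<phi> \<in> w \<longrightarrow> \<phi> \<in> v)"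
    if "(w, v) \<in> rel (canonical_model L)" for v
    using that by (auto simp: canonical_model_def)
  ultimately show ?case using Box.IH by (metis sat.simps(4))
qed (simp_all add: mcs_Bot mcs_Imp, simp add: canonical_model_def)

lemma sound_complete_canonical: "sound_complete L {canonical_model L}"
proof -
  have "\<phi> \<in> L \<longleftrightarrow> (\<forall>w. maximal_consistent L w \<longrightarrow> \<phi> \<in> w)" for \<phi>
  proof
    assume "\<phi> \<in> L"
    then show "\<forall>w. maximal_consistent L w \<longrightarrow> \<phi> \<in> w"
      using mcs_derivable derivable.logic by blast
  next
    assume all: "\<forall>w. maximal_consistent L w \<longrightarrow> \<phi> \<in> w"
    have "derivable L {\<phi> \<^bold>\<rightarrow> \<^bold>\<bottom>} \<^bold>\<bottom>"
    proof (rule ccontr)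
      assume "\<not> derivable L {\<phi> \<^bold>\<rightarrow> \<^bold>\<bottom>} \<^bold>\<bottom>"
      then obtain w where "maximal_consistent L w" "{\<phi> \<^bold>\<rightarrow> \<^bold>\<bottom>} \<subseteq> w" by (rule Lindenbaum)
      then show False using all mcs_Imp mcs_Bot by blast
    qed
    then show "\<phi> \<in> L" by (rule derivable_empty[OF derivable_by_contradiction])
  qed
  then show ?thesis
    using truth_lemma by (auto simp: sound_complete_def canonical_model_def)
qed

text \<open>Consistency of \<open>L\<close> serves to make the set of worlds nonempty.\<close>

lemma kripke_model_canonical:
  assumes "consistent L"
  shows "kripke_model (canonical_model L)"
proof -
  have "\<not> derivable L {} \<^bold>\<bottom>"
    using assms derivable_empty by (auto simp: consistent_def)
  then obtain w where "maximal_consistent L w" by (rule Lindenbaum)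
  then show ?thesis by (auto simp: kripke_model_def canonical_model_def)
qed

end

section \<open>Interpolation and ULIP\<close>

lemma finite_conjunction:
  fixes n :: nat
  assumes "finite S" "S \<subseteq> PQ_formulas n P Q"
  obtains \<theta> where "\<theta> \<in> PQ_formulas n P Q"
    "\<And>(M :: 'w kripke) x. sat M x \<theta> \<longleftrightarrow> (\<forall>\<chi> \<in> S. sat M x \<chi>)"
proof -
  have "\<exists>\<theta> \<in> PQ_formulas n P Q. \<forall>(M :: 'w kripke) x. sat M x \<theta> \<longleftrightarrow> (\<forall>\<chi> \<in> S. sat M x \<chi>)"
    using assms
  proof (induction rule: finite_induct)
    case empty
    then show ?case by (intro bexI[of _ "\<^bold>\<bottom> \<^bold>\<rightarrow> \<^bold>\<bottom>"]) (auto simp: PQ_formulas_def)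
  next
    case (insert \<alpha> S)
    then obtain \<theta> where "\<theta> \<in> PQ_formulas n P Q"
      "\<forall>(M :: 'w kripke) x. sat M x \<theta> \<longleftrightarrow> (\<forall>\<chi> \<in> S. sat M x \<chi>)" by auto
    then show ?case using insert.prems
      \<comment> \<open>Conjunction coded by implication and falsum: both conjuncts sit under an
        even number of negations, so polarities are preserved.\<close>
      by (intro bexI[of _ "(\<alpha> \<^bold>\<rightarrow> \<theta> \<^bold>\<rightarrow> \<^bold>\<bottom>) \<^bold>\<rightarrow> \<^bold>\<bottom>"]) (auto simp: PQ_formulas_def)
  qed
  then show ?thesis using that by blast
qed

lemma finite_disjunction:
  fixes n :: nat
  assumes "finite S" "S \<subseteq> PQ_formulas n P Q"
  obtains \<theta> where "\<theta> \<in> PQ_formulas n P Q"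
    "\<And>(M :: 'w kripke) x. sat M x \<theta> \<longleftrightarrow> (\<exists>\<chi> \<in> S. sat M x \<chi>)"
proof -
  have "\<exists>\<theta> \<in> PQ_formulas n P Q. \<forall>(M :: 'w kripke) x. sat M x \<theta> \<longleftrightarrow> (\<exists>\<chi> \<in> S. sat M x \<chi>)"
    using assms
  proof (induction rule: finite_induct)
    case empty
    then show ?case by (intro bexI[of _ "\<^bold>\<bottom>"]) (auto simp: PQ_formulas_def)
  next
    case (insert \<alpha> S)
    then obtain \<theta> where "\<theta> \<in> PQ_formulas n P Q"
      "\<forall>(M :: 'w kripke) x. sat M x \<theta> \<longleftrightarrow> (\<exists>\<chi> \<in> S. sat M x \<chi>)" by auto
    then show ?case using insert.prems
      \<comment> \<open>Disjunction coded likewise: \<alpha> is doubly negated and so keeps its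
        polarity.\<close>
      by (intro bexI[of _ "(\<alpha> \<^bold>\<rightarrow> \<^bold>\<bottom>) \<^bold>\<rightarrow> \<theta>"]) (auto simp: PQ_formulas_def)
  qed
  then show ?thesis using that by blast
qed

lemma F_finite: "finite P \<Longrightarrow> finite Q \<Longrightarrow> finite (F n P Q)"
  and F_subset: "finite P \<Longrightarrow> finite Q \<Longrightarrow> F n P Q \<subseteq> PQ_formulas n P Q"
  using representatives_F[of P Q n] by (simp_all add: representatives_def)

lemma finite_vpos: "finite (vpos \<phi>)" and finite_vneg: "finite (vneg \<phi>)"
  by (induction \<phi>) auto

section \<open>Logics complete for a class: ULIP versus bounded interpolation\<close>

locale complete_class = normal L for L +
  fixes C :: "'w kripke set"
  assumes sound_complete: "sound_complete L C"
begin

lemma valid: "\<phi> \<in> L \<Longrightarrow> M \<in> C \<Longrightarrow> x \<in> worlds M \<Longrightarrow> sat M x \<phi>"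
  using sound_complete unfolding sound_complete_def by blast

lemma countermodel:
  assumes "(\<phi> \<^bold>\<rightarrow> \<psi>) \<notin> L"
  obtains M x where "M \<in> C" "x \<in> worlds M" "sat M x \<phi>" "\<not> sat M x \<psi>"
  using assms sound_complete unfolding sound_complete_def by auto

lemma representative:
  assumes "finite P" "finite Q" "\<phi> \<in> PQ_formulas n P Q"
  obtains \<psi> where "\<psi> \<in> F n P Q" "(\<phi> \<^bold>\<rightarrow> \<psi>) \<in> L"
    "\<And>M x. M \<in> C \<Longrightarrow> x \<in> worlds M \<Longrightarrow> sat M x \<phi> \<longleftrightarrow> sat M x \<psi>"
proof -
  obtain \<psi> where \<psi>: "\<psi> \<in> F n P Q" "K_equiv \<phi> \<psi>"
    using representatives_F[OF assms(1,2), of n] assms(3) unfolding representatives_def by blast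
  then have "(\<phi> \<^bold>\<rightarrow> \<psi>) \<in> L" "(\<psi> \<^bold>\<rightarrow> \<phi>) \<in> L"
    using K_subset by (auto simp: K_equiv_def)
  then show ?thesis using that[of \<psi>] \<psi>(1) valid by (metis sat.simps(3))
qed

text \<open>Frees theory inclusion from the choice of \<open>F\<close>: equivalence in
  \<open>K\<close>, hence in \<open>L\<close>, makes a formula and its representative agree
  throughout \<open>C\<close>.\<close>

lemma Th_subset_iff:
  assumes "finite P" "finite Q" "M \<in> C" "M' \<in> C" "x \<in> worlds M" "x' \<in> worlds M'"
  shows "Th n P Q M x \<subseteq> Th n P Q M' x' \<longleftrightarrow>
         (\<forall>\<phi> \<in> PQ_formulas n P Q. sat M x \<phi> \<longrightarrow> sat M' x' \<phi>)"
proof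
  assume sub: "Th n P Q M x \<subseteq> Th n P Q M' x'"
  show "\<forall>\<phi> \<in> PQ_formulas n P Q. sat M x \<phi> \<longrightarrow> sat M' x' \<phi>"
  proof (intro ballI impI)
    fix \<phi> assume "\<phi> \<in> PQ_formulas n P Q" "sat M x \<phi>"
    then show "sat M' x' \<phi>"
      using sub assms by (elim representative[OF assms(1,2)]) (auto simp: Th_def)
  qed
next
  assume "\<forall>\<phi> \<in> PQ_formulas n P Q. sat M x \<phi> \<longrightarrow> sat M' x' \<phi>"
  then show "Th n P Q M x \<subseteq> Th n P Q M' x'"
    using F_subset[OF assms(1,2)] by (auto simp: Th_def)
qed

lemma ULIP_if_bounded_uniform_lyndon:
  assumes "bounded_uniform_lyndon L"
  shows "ULIP C"
  unfolding ULIP_def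
proof (intro allI impI ballI, elim conjE)
  fix P1 P2 P3 Q1 Q2 Q3 :: "nat set" and M M' w w' and m n :: nat
  assume fin: "finite P1" "finite P2" "finite P3" "finite Q1" "finite Q2" "finite Q3"
    and disj: "P1 \<inter> P2 = {}" "P1 \<inter> P3 = {}" "Q1 \<inter> Q2 = {}" "Q1 \<inter> Q3 = {}"
    and M: "M \<in> C" "w \<in> worlds M" and M': "M' \<in> C" "w' \<in> worlds M'"
    and Th: "Th n P2 Q2 M w \<subseteq> Th n P2 Q2 M' w'"
  let ?F = "F n (P1 \<union> P2) (Q1 \<union> Q2)" and ?G = "F m (P2 \<union> P3) (Q2 \<union> Q3)"
  have F: "finite {\<chi> \<in> ?F. sat M w \<chi>}"
      "{\<chi> \<in> ?F. sat M w \<chi>} \<subseteq> PQ_formulas n (P1 \<union> P2) (Q1 \<union> Q2)"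
    and G: "finite {\<chi> \<in> ?G. \<not> sat M' w' \<chi>}"
      "{\<chi> \<in> ?G. \<not> sat M' w' \<chi>} \<subseteq> PQ_formulas m (P2 \<union> P3) (Q2 \<union> Q3)"
    using fin by (auto simp: F_finite dest!: subsetD[OF F_subset, rotated -1])
  \<comment> \<open>\<phi> holds exactly where the theory of \<open>w\<close> is preserved; \<psi>
    below fails exactly where every chosen formula true there is also true at \<open>w'\<close>. The
    world sought is thus one satisfying \<phi> but not \<psi>.\<close>
  obtain \<phi> where \<phi>: "\<phi> \<in> PQ_formulas n (P1 \<union> P2) (Q1 \<union> Q2)"
    "\<And>(N :: 'w kripke) x. sat N x \<phi> \<longleftrightarrow> (\<forall>\<chi> \<in> {\<chi> \<in> ?F. sat M w \<chi>}. sat N x \<chi>)"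
    using finite_conjunction[OF F] by blast
  obtain \<psi> where \<psi>: "\<psi> \<in> PQ_formulas m (P2 \<union> P3) (Q2 \<union> Q3)"
    "\<And>(N :: 'w kripke) x. sat N x \<psi> \<longleftrightarrow> (\<exists>\<chi> \<in> {\<chi> \<in> ?G. \<not> sat M' w' \<chi>}. sat N x \<chi>)"
    using finite_disjunction[OF G] by blast
  have "(\<phi> \<^bold>\<rightarrow> \<psi>) \<notin> L"
  proof
    assume imp: "(\<phi> \<^bold>\<rightarrow> \<psi>) \<in> L"
    obtain \<theta> where \<theta>: "uniform_lyndon_interpolant L \<phi> P1 Q1 \<theta>" "depth \<theta> \<le> depth \<phi>"
      using assms fin unfolding bounded_uniform_lyndon_def by blast
    \<comment> \<open>Removing \<open>P1\<close> and \<open>Q1\<close> from the signature of \<phi>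
      leaves at most \<open>P2\<close> and \<open>Q2\<close>. With the depth bound, \<theta> falls
      within the hypothesis relating \<open>w\<close> to \<open>w'\<close>.\<close>
    have "\<theta> \<in> PQ_formulas n P2 Q2"
      using \<theta> \<phi>(1) unfolding uniform_lyndon_interpolant_def PQ_formulas_def by auto
    moreover have "(\<phi> \<^bold>\<rightarrow> \<theta>) \<in> L"
      using \<theta>(1) by (simp add: uniform_lyndon_interpolant_def)
    then have "sat M w \<theta>"
      using valid[OF _ M, of "\<phi> \<^bold>\<rightarrow> \<theta>"] \<phi>(2)[of M w] by simp
    ultimately have "sat M' w' \<theta>"
      using Th Th_subset_iff[OF fin(2,5) M(1) M'(1) M(2) M'(2)] by blast
    moreover have "vpos \<psi> \<inter> P1 = {}" "vneg \<psi> \<inter> Q1 = {}"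
      using \<psi>(1) disj unfolding PQ_formulas_def by blast+
    then have "(\<theta> \<^bold>\<rightarrow> \<psi>) \<in> L"
      using \<theta>(1) imp unfolding uniform_lyndon_interpolant_def by blast
    ultimately have "sat M' w' \<psi>" using valid[OF _ M', of "\<theta> \<^bold>\<rightarrow> \<psi>"] by simp
    then show False using \<psi>(2) by simp
  qed
  then obtain N x where "N \<in> C" "x \<in> worlds N" "sat N x \<phi>" "\<not> sat N x \<psi>"
    by (rule countermodel)
  then show "\<exists>M'' \<in> C. \<exists>w'' \<in> worlds M''.
      Th n (P1 \<union> P2) (Q1 \<union> Q2) M w \<subseteq> Th n (P1 \<union> P2) (Q1 \<union> Q2) M'' w'' \<and>
      Th m (P2 \<union> P3) (Q2 \<union> Q3) M'' w'' \<subseteq> Th m (P2 \<union> P3) (Q2 \<union> Q3) M' w'"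
    using \<phi>(2) \<psi>(2) by (intro bexI[of _ N] bexI[of _ x]) (auto simp: Th_def)
qed

lemma bounded_uniform_lyndon_if_ULIP:
  assumes "ULIP C"
  shows "bounded_uniform_lyndon L"
  unfolding bounded_uniform_lyndon_def
proof (intro allI impI)
  fix \<phi> and P Q :: "nat set"
  let ?n = "depth \<phi>"
  \<comment> \<open>The signature of \<phi> is split into a part to be eliminated and a part that
    the interpolant may keep.\<close>
  define P1 P2 Q1 Q2 where "P1 = vpos \<phi> \<inter> P" "P2 = vpos \<phi> - P" "Q1 = vneg \<phi> \<inter> Q" "Q2 = vneg \<phi> - Q"
  note defs = this
  have fin: "finite P1" "finite P2" "finite Q1" "finite Q2"
    by (simp_all add: defs finite_vpos finite_vneg)
  let ?F = "F ?n P2 Q2"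
  have "finite {\<chi> \<in> ?F. (\<phi> \<^bold>\<rightarrow> \<chi>) \<in> L}" "{\<chi> \<in> ?F. (\<phi> \<^bold>\<rightarrow> \<chi>) \<in> L} \<subseteq> PQ_formulas ?n P2 Q2"
    using fin by (auto simp: F_finite dest!: subsetD[OF F_subset, rotated -1])
  then obtain \<theta> where \<theta>: "\<theta> \<in> PQ_formulas ?n P2 Q2"
    "\<And>(N :: 'w kripke) x. sat N x \<theta> \<longleftrightarrow> (\<forall>\<chi> \<in> {\<chi> \<in> ?F. (\<phi> \<^bold>\<rightarrow> \<chi>) \<in> L}. sat N x \<chi>)"
    using finite_conjunction by blast
  have "(\<phi> \<^bold>\<rightarrow> \<theta>) \<in> L"
  proof (rule ccontr)
    assume "(\<phi> \<^bold>\<rightarrow> \<theta>) \<notin> L"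
    then obtain N x where "N \<in> C" "x \<in> worlds N" "sat N x \<phi>" "\<not> sat N x \<theta>"
      by (rule countermodel)
    then show False using \<theta>(2) valid by fastforce
  qed
  moreover have "(\<theta> \<^bold>\<rightarrow> \<psi>) \<in> L"
    if \<psi>: "vpos \<psi> \<inter> P = {}" "vneg \<psi> \<inter> Q = {}" "(\<phi> \<^bold>\<rightarrow> \<psi>) \<in> L" for \<psi>
  proof (rule ccontr)
    assume "(\<theta> \<^bold>\<rightarrow> \<psi>) \<notin> L"
    then obtain M' w' where M': "M' \<in> C" "w' \<in> worlds M'" "sat M' w' \<theta>" "\<not> sat M' w' \<psi>"
      by (rule countermodel)
    have "finite {\<chi> \<in> ?F. \<not> sat M' w' \<chi>}" "{\<chi> \<in> ?F. \<not> sat M' w' \<chi>} \<subseteq> PQ_formulas ?n P2 Q2"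
      using fin by (auto simp: F_finite dest!: subsetD[OF F_subset, rotated -1])
    \<comment> \<open>\<delta> collects what \<open>w'\<close> refutes in the interpolant's
      signature, so a world refuting \<delta> has its theory included in that of
      \<open>w'\<close>.\<close>
    then obtain \<delta> where \<delta>: "\<delta> \<in> PQ_formulas ?n P2 Q2"
      "\<And>(N :: 'w kripke) x. sat N x \<delta> \<longleftrightarrow> (\<exists>\<chi> \<in> {\<chi> \<in> ?F. \<not> sat M' w' \<chi>}. sat N x \<chi>)"
      using finite_disjunction by blast
    have "(\<phi> \<^bold>\<rightarrow> \<delta>) \<notin> L"
    proof
      assume imp: "(\<phi> \<^bold>\<rightarrow> \<delta>) \<in> L"
      \<comment> \<open>\<delta> need not belong to \<open>F\<close>, but its representative \<chi>
        does, and so is one of the conjuncts of \<theta> and true at \<open>w'\<close>.\<close>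
      obtain \<chi> where \<chi>: "\<chi> \<in> ?F" "(\<delta> \<^bold>\<rightarrow> \<chi>) \<in> L"
        "\<And>M x. M \<in> C \<Longrightarrow> x \<in> worlds M \<Longrightarrow> sat M x \<delta> \<longleftrightarrow> sat M x \<chi>"
        using representative[OF fin(2,4) \<delta>(1)] by blast
      have "((\<phi> \<^bold>\<rightarrow> \<delta>) \<^bold>\<rightarrow> (\<delta> \<^bold>\<rightarrow> \<chi>) \<^bold>\<rightarrow> (\<phi> \<^bold>\<rightarrow> \<chi>)) \<in> L"
        by (rule taut) (simp add: tautology_def)
      then have "(\<phi> \<^bold>\<rightarrow> \<chi>) \<in> L" using imp \<chi>(2) modus_ponens by blast
      then have "sat M' w' \<delta>" using \<chi> M' \<theta>(2) by blast
      then show False using \<delta>(2) by blast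
    qed
    then obtain M w where M: "M \<in> C" "w \<in> worlds M" "sat M w \<phi>" "\<not> sat M w \<delta>"
      by (rule countermodel)
    have Th: "Th ?n P2 Q2 M w \<subseteq> Th ?n P2 Q2 M' w'"
      using M(4) \<delta>(2) by (auto simp: Th_def)
    \<comment> \<open>\<open>P2\<close> and \<open>P3\<close> together cover the positive variables
      of \<psi>. \<open>P3\<close> misses \<open>P1\<close> because \<psi> has no positive variable
      in \<open>P\<close>; likewise for \<open>Q3\<close>.\<close>
    define P3 Q3 where "P3 = vpos \<psi> - P2" "Q3 = vneg \<psi> - Q2"
    note defs3 = this
    have fin3: "finite P3" "finite Q3" by (simp_all add: defs3 finite_vpos finite_vneg)
    have disj: "P1 \<inter> P2 = {}" "P1 \<inter> P3 = {}" "P2 \<inter> P3 = {}"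
      "Q1 \<inter> Q2 = {}" "Q1 \<inter> Q3 = {}" "Q2 \<inter> Q3 = {}"
      using \<psi>(1,2) by (auto simp: defs defs3)
    obtain N x where N: "N \<in> C" "x \<in> worlds N"
      "Th ?n (P1 \<union> P2) (Q1 \<union> Q2) M w \<subseteq> Th ?n (P1 \<union> P2) (Q1 \<union> Q2) N x"
      "Th (depth \<psi>) (P2 \<union> P3) (Q2 \<union> Q3) N x \<subseteq> Th (depth \<psi>) (P2 \<union> P3) (Q2 \<union> Q3) M' w'"
      using assms[unfolded ULIP_def, rule_format, of P1 P2 P3 Q1 Q2 Q3 M M' w w' ?n "depth \<psi>"]
        fin fin3 disj M(1,2) M'(1,2) Th by blast
    have "\<phi> \<in> PQ_formulas ?n (P1 \<union> P2) (Q1 \<union> Q2)" "\<psi> \<in> PQ_formulas (depth \<psi>) (P2 \<union> P3) (Q2 \<union> Q3)"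
      by (auto simp: PQ_formulas_def defs defs3)
    \<comment> \<open>\<phi> passes from \<open>w\<close> to \<open>x\<close>, there yields \<psi>
      by soundness, and \<psi> passes from \<open>x\<close> to \<open>w'\<close>, contradicting its
      choice.\<close>
    moreover have "sat N x \<phi>"
      using N(3) M(3) calculation(1) fin by (simp add: Th_subset_iff[OF _ _ M(1) N(1) M(2) N(2)])
    then have "sat N x \<psi>" using valid[OF \<psi>(3) N(1,2)] by simp
    ultimately have "sat M' w' \<psi>"
      using N(4) fin fin3 by (simp add: Th_subset_iff[OF _ _ N(1) M'(1) N(2) M'(2)])
    then show False using M'(4) by simp
  qed
  ultimately have "uniform_lyndon_interpolant L \<phi> P Q \<theta>" "depth \<theta> \<le> ?n"
    using \<theta>(1) by (auto simp: uniform_lyndon_interpolant_def PQ_formulas_def defs)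
  then show "\<exists>\<theta>. uniform_lyndon_interpolant L \<phi> P Q \<theta> \<and> depth \<theta> \<le> ?n" by blast
qed

end

lemma complete_classI: "normal_logic L \<Longrightarrow> sound_complete L C \<Longrightarrow> complete_class L C"
  by unfold_locales

text \<open>A class of models fixes its type of worlds. The equivalence uses \<open>fm set\<close>,
  the type of canonical worlds, so that interpolation can produce a class; the second conjunct gives
  the converse for classes over an arbitrary type of worlds.\<close>

theorem theorem4p2:
  fixes L :: "fm set"
  assumes "normal_logic L" and "consistent L"
  shows "(bounded_uniform_lyndon L \<longleftrightarrow>
            (\<exists>C :: fm set kripke set.
               (\<forall>M \<in> C. kripke_model M) \<and> sound_complete L C \<and> ULIP C)) \<and>
         ((\<exists>C :: 'w kripke set.
               (\<forall>M \<in> C. kripke_model M) \<and> sound_complete L C \<and> ULIP C) \<longrightarrow>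
            bounded_uniform_lyndon L)"
proof -
  interpret normal L by unfold_locales (rule assms(1))
  interpret canonical: complete_class L "{canonical_model L}"
    by (rule complete_classI[OF assms(1) sound_complete_canonical])
  have "\<exists>C :: fm set kripke set. (\<forall>M \<in> C. kripke_model M) \<and> sound_complete L C \<and> ULIP C"
    if "bounded_uniform_lyndon L"
    using kripke_model_canonical[OF assms(2)] sound_complete_canonical
      canonical.ULIP_if_bounded_uniform_lyndon[OF that]
    by (intro exI[of _ "{canonical_model L}"]) simp
  note complete = this
    and bounded = complete_class.bounded_uniform_lyndon_if_ULIP[OF complete_classI[OF assms(1)]]
  show ?thesis
    by (intro conjI iffI impI; (erule complete | elim exE conjE, erule (1) bounded))
qed

end
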